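(* Let $G$ be a non-elementary hyperbolic group. Then $\mathrm{cr}_X(G)=0$ for every finite generating set $X$ of $G$.
   Context: For a group $G$ with finite generating set $X$, $\mathbb{B}_{G,X}(n)$ is the ball of radius $n$ about the identity for the word length over $X\cup X^{-1}$, and $C_{G,X}(n)$ is the set of conjugacy classes of $G$ having a representative in $\mathbb{B}_{G,X}(n)$. The conjugacy ratio is $\mathrm{cr}_X(G)=\limsup_{n\to\infty}\frac{|C_{G,X}(n)|}{|\mathbb{B}_{G,X}(n)|}$. Hyperbolic means (finitely generated and) Gromov hyperbolic; non-elementary means not virtually cyclic. *)

theory Defs
  imports
    "HOL-Library.Extended_Real"
    "HOL-Algebra.Elementary_Groups"
    "HOL-Algebra.Group_Action"
begin

section \<open>Word length and balls\<close>

definition finite_generating_set :: "('a, 'b) monoid_scheme \<Rightarrow> 'a set \<Rightarrow> bool" where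
  "finite_generating_set G X \<longleftrightarrow> finite X \<and> X \<subseteq> carrier G \<and> generate G X = carrier G"

text \<open>Only meaningful when \<open>X\<close> generates \<open>G\<close> and \<open>g \<in> carrier G\<close>: otherwise the set of
  lengths may be empty and its least element is unspecified.\<close>

definition word_length :: "('a, 'b) monoid_scheme \<Rightarrow> 'a set \<Rightarrow> 'a \<Rightarrow> nat" where
  "word_length G X g =
     (LEAST n. \<exists>w. set w \<subseteq> X \<union> m_inv G ` X \<and> length w = n \<and>
                   foldr (\<otimes>\<^bsub>G\<^esub>) w \<one>\<^bsub>G\<^esub> = g)"

definition word_dist :: "('a, 'b) monoid_scheme \<Rightarrow> 'a set \<Rightarrow> 'a \<Rightarrow> 'a \<Rightarrow> real" where
  "word_dist G X g h = real (word_length G X (inv\<^bsub>G\<^esub> g \<otimes>\<^bsub>G\<^esub> h))"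

definition word_ball :: "('a, 'b) monoid_scheme \<Rightarrow> 'a set \<Rightarrow> nat \<Rightarrow> 'a set" where
  "word_ball G X n = {g \<in> carrier G. word_length G X g \<le> n}"


section \<open>Conjugacy ratio\<close>

definition conjugacy_classes :: "('a, 'b) monoid_scheme \<Rightarrow> 'a set set" where
  "conjugacy_classes G =
     orbits G (carrier G) (\<lambda>h g. h \<otimes>\<^bsub>G\<^esub> g \<otimes>\<^bsub>G\<^esub> inv\<^bsub>G\<^esub> h)"

definition conjugacy_ball :: "('a, 'b) monoid_scheme \<Rightarrow> 'a set \<Rightarrow> nat \<Rightarrow> 'a set set" where
  "conjugacy_ball G X n = {c \<in> conjugacy_classes G. c \<inter> word_ball G X n \<noteq> {}}"

definition conjugacy_ratio :: "('a, 'b) monoid_scheme \<Rightarrow> 'a set \<Rightarrow> ereal" where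
  "conjugacy_ratio G X =
     limsup (\<lambda>n. ereal (real (card (conjugacy_ball G X n)) / real (card (word_ball G X n))))"


section \<open>Hyperbolic groups\<close>

definition Gromov_product :: "('a \<Rightarrow> 'a \<Rightarrow> real) \<Rightarrow> 'a \<Rightarrow> 'a \<Rightarrow> 'a \<Rightarrow> real" where
  "Gromov_product d p x y = (d x p + d y p - d x y) / 2"

definition Gromov_hyperbolic :: "'a set \<Rightarrow> ('a \<Rightarrow> 'a \<Rightarrow> real) \<Rightarrow> bool" where
  "Gromov_hyperbolic M d \<longleftrightarrow>
     (\<exists>\<delta>\<ge>0. \<forall>p\<in>M. \<forall>x\<in>M. \<forall>y\<in>M. \<forall>z\<in>M.
        Gromov_product d p x z \<ge> min (Gromov_product d p x y) (Gromov_product d p y z) - \<delta>)"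

text \<open>Gromov's definition, applied to the group itself as a metric space (the vertex set of the
  Cayley graph). As usual, one finite generating set with a hyperbolic word metric suffices.\<close>

definition hyperbolic_group :: "('a, 'b) monoid_scheme \<Rightarrow> bool" where
  "hyperbolic_group G \<longleftrightarrow> group G \<and>
     (\<exists>S. finite_generating_set G S \<and> Gromov_hyperbolic (carrier G) (word_dist G S))"

definition virtually_cyclic :: "('a, 'b) monoid_scheme \<Rightarrow> bool" where
  "virtually_cyclic G \<longleftrightarrow>
     (\<exists>H. subgroup H G \<and> finite (rcosets\<^bsub>G\<^esub> H) \<and> cyclic_group (G\<lparr>carrier := H\<rparr>))"

end

theory Submission
  imports Defs
begin

text \<open>
  Fix \<open>K\<close>. Classes with at least \<open>K\<close> elements in the ball \<open>B(n)\<close> number at most \<open>|B(n)| / K\<close>.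
  In a class with fewer elements, many conjugates of a geodesic word \<open>g\<close> by its own prefixes
  coincide, so some conjugate of \<open>g\<close> commutes with many distinct elements of bounded length.
  All but finitely many classes contain an element \<open>g\<close> acting as a translation along a
  quasi-geodesic, and for those only boundedly many elements of the centralizer are not
  themselves such translations. Hence all sparse classes, up to finitely many, meet the
  centralizer of one of finitely many translations \<open>v\<close>, and these centralizers have linear growth.
  The group itself grows faster than linearly because the cyclic subgroup of a translation has
  infinite index. Hyperbolicity is used for a single generating set; the word
  lengths of any other one are linearly comparable.
\<close>

section \<open>Word length\<close>

context group
begin

lemma inv_mult_cancel [simp]:
  "x \<in> carrier G \<Longrightarrow> y \<in> carrier G \<Longrightarrow> inv x \<otimes> (x \<otimes> y) = y"
  by (simp add: m_assoc [symmetric])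

lemma mult_inv_cancel [simp]:
  "x \<in> carrier G \<Longrightarrow> y \<in> carrier G \<Longrightarrow> x \<otimes> (inv x \<otimes> y) = y"
  by (simp add: m_assoc [symmetric])

lemma inv_commute:
  assumes "x \<in> carrier G" "y \<in> carrier G" "x \<otimes> y = y \<otimes> x"
  shows "inv x \<otimes> y = y \<otimes> inv x"
proof -
  have "inv x \<otimes> (x \<otimes> y) \<otimes> inv x = inv x \<otimes> (y \<otimes> x) \<otimes> inv x"
    using assms by simp
  then show ?thesis
    using assms(1,2) by (simp add: m_assoc)
qed

lemma nat_pow_Suc_left: "x \<in> carrier G \<Longrightarrow> x [^] Suc n = x \<otimes> x [^] n"
  using nat_pow_Suc2 by simp

lemma foldr_mult_closed: "set w \<subseteq> carrier G \<Longrightarrow> foldr (\<otimes>) w \<one> \<in> carrier G"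
  by (induction w) auto

lemma foldr_mult_append:
  "set v \<subseteq> carrier G \<Longrightarrow> set w \<subseteq> carrier G \<Longrightarrow>
    foldr (\<otimes>) (v @ w) \<one> = foldr (\<otimes>) v \<one> \<otimes> foldr (\<otimes>) w \<one>"
  by (induction v) (auto simp: foldr_mult_closed m_assoc)

lemma foldr_mult_rev:
  "set w \<subseteq> carrier G \<Longrightarrow> foldr (\<otimes>) (rev (map (m_inv G) w)) \<one> = inv (foldr (\<otimes>) w \<one>)"
proof (induction w)
  case (Cons a w)
  have "set (rev (map (m_inv G) w)) \<subseteq> carrier G"
    using Cons.prems by auto
  then show ?case
    using Cons by (simp add: foldr_mult_append inv_mult_group foldr_mult_closed
        del: foldr_append)
qed simp

section \<open>Centralizers and conjugacy classes\<close>

definition centralizer :: "'a \<Rightarrow> 'a set" where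
  "centralizer g = {h \<in> carrier G. h \<otimes> g = g \<otimes> h}"

text \<open>The action is written as in \<open>conjugacy_classes\<close>, so that classes and orbits
  agree by unfolding.\<close>

abbreviation conj_class :: "'a \<Rightarrow> 'a set" where
  "conj_class \<equiv> orbit G (\<lambda>h g. h \<otimes> g \<otimes> inv h)"

lemma mem_conj_class_iff:
  "h \<in> conj_class g \<longleftrightarrow> (\<exists>p\<in>carrier G. h = p \<otimes> g \<otimes> inv p)"
  by (auto simp: orbit_def)

lemma conj_class_closed: "g \<in> carrier G \<Longrightarrow> h \<in> conj_class g \<Longrightarrow> h \<in> carrier G"
  by (auto simp: mem_conj_class_iff)

lemma conj_conj:
  "\<lbrakk>p \<in> carrier G; q \<in> carrier G; g \<in> carrier G\<rbrakk>
    \<Longrightarrow> p \<otimes> (q \<otimes> g \<otimes> inv q) \<otimes> inv p = (p \<otimes> q) \<otimes> g \<otimes> inv (p \<otimes> q)"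
  by (simp add: m_assoc inv_mult_group)

lemma conj_class_sym:
  assumes "g \<in> carrier G" "h \<in> conj_class g"
  shows "g \<in> conj_class h"
proof -
  obtain p where p: "p \<in> carrier G" "h = p \<otimes> g \<otimes> inv p"
    using assms by (auto simp: mem_conj_class_iff)
  then have "g = inv p \<otimes> h \<otimes> inv (inv p)"
    using assms by (simp add: m_assoc)
  then show ?thesis
    unfolding mem_conj_class_iff using p(1) by blast
qed

lemma conj_class_trans:
  assumes "g \<in> carrier G" "h \<in> conj_class g" "k \<in> conj_class h"
  shows "k \<in> conj_class g"
proof -
  obtain p q where "p \<in> carrier G" "h = p \<otimes> g \<otimes> inv p" "q \<in> carrier G" "k = q \<otimes> h \<otimes> inv q"
    using assms by (auto simp: mem_conj_class_iff)
  then show ?thesis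
    using assms by (auto simp: mem_conj_class_iff conj_conj)
qed

lemma conj_class_eq:
  assumes "g \<in> carrier G" "h \<in> conj_class g"
  shows "conj_class h = conj_class g"
proof (intro equalityI subsetI)
  have h: "h \<in> carrier G" and g: "g \<in> conj_class h"
    using assms by (auto intro: conj_class_closed conj_class_sym)
  fix k
  show "k \<in> conj_class g" if "k \<in> conj_class h"
    using conj_class_trans [OF assms that] .
  show "k \<in> conj_class h" if "k \<in> conj_class g"
    using conj_class_trans [OF h g that] .
qed

lemma conj_class_self: "g \<in> carrier G \<Longrightarrow> g \<in> conj_class g"
  unfolding mem_conj_class_iff by (intro bexI [of _ \<one>]) auto

lemma conjugacy_classes_eq: "conjugacy_classes G = conj_class ` carrier G"
  by (auto simp: conjugacy_classes_def orbits_def)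

lemma conj_image_centralizer:
  assumes "g \<in> carrier G" "h \<in> centralizer g" "p \<in> carrier G"
  shows "p \<otimes> h \<otimes> inv p \<in> centralizer (p \<otimes> g \<otimes> inv p)"
proof -
  have h: "h \<in> carrier G" "h \<otimes> g = g \<otimes> h"
    using assms by (auto simp: centralizer_def)
  have "(p \<otimes> h \<otimes> inv p) \<otimes> (p \<otimes> g \<otimes> inv p) = p \<otimes> (h \<otimes> g) \<otimes> inv p"
    using assms h(1) by (simp add: m_assoc)
  moreover have "(p \<otimes> g \<otimes> inv p) \<otimes> (p \<otimes> h \<otimes> inv p) = p \<otimes> (g \<otimes> h) \<otimes> inv p"
    using assms h(1) by (simp add: m_assoc)
  ultimately show ?thesis
    using assms h by (simp add: centralizer_def)
qed

lemma inj_on_conj: "p \<in> carrier G \<Longrightarrow> inj_on (\<lambda>h. p \<otimes> h \<otimes> inv p) (carrier G)"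
  by (auto intro!: inj_onI)

end

section \<open>Word length over a finite generating set\<close>

locale word_metric = group G for G :: "('a, 'b) monoid_scheme" (structure) +
  fixes X :: "'a set"
  assumes generating: "finite_generating_set G X"
begin

abbreviation len :: "'a \<Rightarrow> nat" where
  "len \<equiv> word_length G X"

abbreviation letters :: "'a set" where
  "letters \<equiv> X \<union> m_inv G ` X"

lemma finite_gens: "finite X" and gens_closed: "X \<subseteq> carrier G"
  and generate_gens: "generate G X = carrier G"
  using generating by (auto simp: finite_generating_set_def)

lemma letters_closed: "letters \<subseteq> carrier G"
  using gens_closed by auto

lemma inv_letters: "x \<in> letters \<Longrightarrow> inv x \<in> letters"
  using gens_closed by auto

lemma ex_word:
  assumes "g \<in> carrier G"
  shows "\<exists>w. set w \<subseteq> letters \<and> foldr (\<otimes>) w \<one> = g"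
proof -
  have "g \<in> generate G X"
    using assms generate_gens by simp
  then show ?thesis
  proof induction
    case one
    show ?case by (rule exI [of _ "[]"]) simp
  next
    case (incl h)
    then show ?case using gens_closed by (intro exI [of _ "[h]"]) auto
  next
    case (inv h)
    then show ?case using gens_closed by (intro exI [of _ "[inv h]"]) auto
  next
    case (eng g h)
    then obtain v w where "set v \<subseteq> letters" "foldr (\<otimes>) v \<one> = g"
      "set w \<subseteq> letters" "foldr (\<otimes>) w \<one> = h" by blast
    then show ?case
      using letters_closed foldr_mult_append [of v w]
      by (intro exI [of _ "v @ w"]) (auto simp del: foldr_append)
  qed
qed

lemma len_word_le:
  assumes "set w \<subseteq> letters"
  shows "len (foldr (\<otimes>) w \<one>) \<le> length w"
  unfolding word_length_def using assms by (intro Least_le) auto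

lemma geodesic_word:
  assumes "g \<in> carrier G"
  obtains w where "set w \<subseteq> letters" "length w = len g" "foldr (\<otimes>) w \<one> = g"
proof -
  have "\<exists>n w. set w \<subseteq> letters \<and> length w = n \<and> foldr (\<otimes>) w \<one> = g"
    using ex_word [OF assms] by auto
  from LeastI_ex [OF this] that show ?thesis
    unfolding word_length_def by blast
qed

lemma len_one [simp]: "len \<one> = 0"
  using len_word_le [of "[]"] by simp

lemma len_mult_le:
  assumes "g \<in> carrier G" "h \<in> carrier G"
  shows "len (g \<otimes> h) \<le> len g + len h"
proof -
  obtain v where v: "set v \<subseteq> letters" "length v = len g" "foldr (\<otimes>) v \<one> = g"
    using geodesic_word [OF assms(1)] .
  obtain w where w: "set w \<subseteq> letters" "length w = len h" "foldr (\<otimes>) w \<one> = h"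
    using geodesic_word [OF assms(2)] .
  have "len (foldr (\<otimes>) (v @ w) \<one>) \<le> length (v @ w)"
    using v w by (intro len_word_le) auto
  then show ?thesis
    using v w foldr_mult_append [of v w] letters_closed by (simp del: foldr_append)
qed

lemma len_inv_le:
  assumes "g \<in> carrier G"
  shows "len (inv g) \<le> len g"
proof -
  obtain w where w: "set w \<subseteq> letters" "length w = len g" "foldr (\<otimes>) w \<one> = g"
    using geodesic_word [OF assms] .
  have "len (foldr (\<otimes>) (rev (map (m_inv G) w)) \<one>) \<le> length (rev (map (m_inv G) w))"
    using w inv_letters by (intro len_word_le) auto
  moreover have "foldr (\<otimes>) (rev (map (m_inv G) w)) \<one> = inv g"
    using w letters_closed by (metis foldr_mult_rev subset_trans)
  ultimately show ?thesis
    using w by simp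
qed

lemma len_inv [simp]: "g \<in> carrier G \<Longrightarrow> len (inv g) = len g"
  using len_inv_le [of g] len_inv_le [of "inv g"] by simp

text \<open>Cut a geodesic word after \<open>k\<close> letters. Neither piece has a shorter word,
  since the two lengths must add up to at least \<open>len g\<close>.\<close>

lemma geodesic_split:
  assumes "g \<in> carrier G" "k \<le> len g"
  obtains u where "u \<in> carrier G" "len u = k" "len (inv u \<otimes> g) = len g - k"
proof -
  obtain w where w: "set w \<subseteq> letters" "length w = len g" "foldr (\<otimes>) w \<one> = g"
    using geodesic_word [OF assms(1)] .
  define u v where "u = foldr (\<otimes>) (take k w) \<one>" and "v = foldr (\<otimes>) (drop k w) \<one>"
  have sub: "set (take k w) \<subseteq> letters" "set (drop k w) \<subseteq> letters"
    using w(1) set_take_subset set_drop_subset by fast+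
  then have closed: "u \<in> carrier G" "v \<in> carrier G"
    unfolding u_def v_def using letters_closed by (meson foldr_mult_closed subset_trans)+
  have "foldr (\<otimes>) (take k w @ drop k w) \<one> = u \<otimes> v"
    unfolding u_def v_def using sub letters_closed
    by (intro foldr_mult_append) (meson subset_trans)+
  then have g: "g = u \<otimes> v"
    using w by simp
  have "len u \<le> k" "len v \<le> len g - k"
    using len_word_le [OF sub(1)] len_word_le [OF sub(2)] w assms
    by (auto simp: u_def v_def)
  moreover have "len g \<le> len u + len v"
    using g len_mult_le closed by simp
  ultimately have "len u = k" "len v = len g - k"
    using assms by auto
  then show ?thesis
    using that closed g by simp
qed

section \<open>Balls and change of generating set\<close>

abbreviation ball :: "nat \<Rightarrow> 'a set" where
  "ball \<equiv> word_ball G X"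

lemma mem_ball_iff: "g \<in> ball n \<longleftrightarrow> g \<in> carrier G \<and> len g \<le> n"
  by (simp add: word_ball_def)

lemma finite_ball [simp]: "finite (ball n)"
proof (rule finite_subset)
  show "ball n \<subseteq> (\<lambda>w. foldr (\<otimes>) w \<one>) ` {w. set w \<subseteq> letters \<and> length w \<le> n}"
  proof
    fix g assume "g \<in> ball n"
    then have g: "g \<in> carrier G" "len g \<le> n" by (auto simp: mem_ball_iff)
    obtain w where "set w \<subseteq> letters" "length w = len g" "foldr (\<otimes>) w \<one> = g"
      using geodesic_word [OF g(1)] .
    then show "g \<in> (\<lambda>w. foldr (\<otimes>) w \<one>) ` {w. set w \<subseteq> letters \<and> length w \<le> n}"
      using g by auto
  qed
  show "finite ((\<lambda>w. foldr (\<otimes>) w \<one>) ` {w. set w \<subseteq> letters \<and> length w \<le> n})"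
    using finite_gens by (intro finite_imageI finite_lists_length_le) auto
qed

lemma one_in_ball: "\<one> \<in> ball n"
  by (simp add: mem_ball_iff)

lemma card_ball_pos: "card (ball n) > 0"
  using one_in_ball by (auto simp: card_gt_0_iff)

lemma finite_subset_ball:
  assumes "finite A" "A \<subseteq> carrier G"
  obtains r where "A \<subseteq> ball r"
proof
  show "A \<subseteq> ball (Max (len ` A))"
    using assms by (auto simp: mem_ball_iff)
qed

lemma ex_minimal_conj:
  assumes "g \<in> carrier G"
  obtains h where "h \<in> conj_class g" "\<And>k. k \<in> conj_class h \<Longrightarrow> len h \<le> len k"
proof -
  obtain h where h: "h \<in> conj_class g" "\<And>k. k \<in> conj_class g \<Longrightarrow> len h \<le> len k"
    using ex_has_least_nat [of "\<lambda>h. h \<in> conj_class g" g len] conj_class_self [OF assms] by blast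
  then show ?thesis
    using that conj_class_eq [OF assms] by blast
qed

lemma len_pow_le: "g \<in> carrier G \<Longrightarrow> len (g [^] (n::nat)) \<le> n * len g"
proof (induction n)
  case (Suc n)
  then show ?case
    using len_mult_le [of "g [^] n" g] by simp
qed simp

text \<open>The finitely many letters over \<open>Y\<close> have bounded length over
  \<open>X\<close>, and \<open>C\<close> is a common bound. This lets counts made in the hyperbolic
  word metric serve any other one.\<close>

lemma len_le_mult_word_length:
  assumes "finite_generating_set G Y"
  obtains C where "\<And>g. g \<in> carrier G \<Longrightarrow> len g \<le> C * word_length G Y g"
proof -
  interpret Y: word_metric G Y
    by unfold_locales (rule assms)
  obtain C where C: "Y.letters \<subseteq> ball C"
    using finite_subset_ball [of Y.letters] Y.finite_gens Y.letters_closed by auto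
  have word: "len (foldr (\<otimes>) w \<one>) \<le> C * length w" if "set w \<subseteq> Y.letters" for w
    using that
  proof (induction w)
    case (Cons a w)
    have "a \<in> ball C" using Cons.prems C by auto
    then have "a \<in> carrier G" "len a \<le> C" by (auto simp: mem_ball_iff)
    moreover have "foldr (\<otimes>) w \<one> \<in> carrier G"
      using Cons.prems Y.letters_closed foldr_mult_closed [of w] by auto
    ultimately show ?case
      using Cons len_mult_le [of a "foldr (\<otimes>) w \<one>"] by simp
  qed simp
  show ?thesis
  proof
    fix g assume "g \<in> carrier G"
    then obtain w where "set w \<subseteq> Y.letters" "length w = Y.len g" "foldr (\<otimes>) w \<one> = g"
      using Y.geodesic_word by blast
    then show "len g \<le> C * Y.len g"
      using word [of w] by simp
  qed
qed

end

section \<open>Hyperbolic word metrics\<close>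

text \<open>Products are based at the identity: the word metric is left invariant, so other base
  points are reached by translation.\<close>

locale hyperbolic_word_metric = word_metric +
  fixes \<delta> :: real
  assumes delta_nonneg: "\<delta> \<ge> 0"
    and hyperbolic: "\<And>x y z. \<lbrakk>x \<in> carrier G; y \<in> carrier G; z \<in> carrier G\<rbrakk> \<Longrightarrow>
      min (Gromov_product (word_dist G X) \<one> x y) (Gromov_product (word_dist G X) \<one> y z) - \<delta>
        \<le> Gromov_product (word_dist G X) \<one> x z"
begin

definition gp :: "'a \<Rightarrow> 'a \<Rightarrow> real" where
  "gp x y = (real (len x) + real (len y) - real (len (inv x \<otimes> y))) / 2"

lemma gp_eq:
  "x \<in> carrier G \<Longrightarrow> y \<in> carrier G \<Longrightarrow> Gromov_product (word_dist G X) \<one> x y = gp x y"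
  by (simp add: Gromov_product_def word_dist_def gp_def)

lemma gp_hyperbolic:
  assumes "x \<in> carrier G" "y \<in> carrier G" "z \<in> carrier G" "gp x y \<ge> a" "gp y z \<ge> a"
  shows "gp x z \<ge> a - \<delta>"
  using hyperbolic [of x y z] assms by (simp add: gp_eq)

text \<open>Hyperbolicity in contrapositive form: if \<open>y\<close> follows \<open>z\<close> for
  long while \<open>z\<close> leaves \<open>x\<close> early, then \<open>y\<close> leaves
  \<open>x\<close> early.\<close>

lemma gp_le_of_gp_gt:
  assumes "x \<in> carrier G" "y \<in> carrier G" "z \<in> carrier G" "gp x z \<le> a" "gp y z > a + \<delta>"
  shows "gp x y \<le> a + \<delta>"
  using hyperbolic [of x y z] assms by (simp add: gp_eq min_def split: if_splits)

lemma gp_commute: "x \<in> carrier G \<Longrightarrow> y \<in> carrier G \<Longrightarrow> gp x y = gp y x"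
  using len_inv [of "inv x \<otimes> y"] by (simp add: gp_def inv_mult_group)

lemma gp_nonneg: "x \<in> carrier G \<Longrightarrow> y \<in> carrier G \<Longrightarrow> gp x y \<ge> 0"
  using len_mult_le [of "inv x" y] by (simp add: gp_def)

lemma gp_one [simp]: "x \<in> carrier G \<Longrightarrow> gp \<one> x = 0" "x \<in> carrier G \<Longrightarrow> gp x \<one> = 0"
  by (auto simp: gp_def)

text \<open>The Gromov products at the two ends of a side add up to its length;
  the one at \<open>x\<close> is translated to the identity.\<close>

lemma gp_add_gp_inv:
  "x \<in> carrier G \<Longrightarrow> y \<in> carrier G \<Longrightarrow> gp x y + gp (inv x) (inv x \<otimes> y) = len x"
  by (simp add: gp_def field_simps)

text \<open>The two distances are the lengths of \<open>x \<otimes> y\<close> and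
  \<open>inv x \<otimes> inv y\<close>, which are inverse to each other when \<open>x\<close> and
  \<open>y\<close> commute.\<close>

lemma gp_inv_left:
  assumes "x \<in> carrier G" "y \<in> carrier G" "x \<otimes> y = y \<otimes> x"
  shows "gp (inv x) y = gp x (inv y)"
proof -
  have "len (inv x \<otimes> inv y) = len (x \<otimes> y)"
    using assms(1,2) len_inv [of "y \<otimes> x"] by (simp add: inv_mult_group assms(3))
  then show ?thesis
    using assms by (simp add: gp_def)
qed

text \<open>The orbit of the identity under such an element is a local geodesic up to the error
  \<open>c\<close>; its displacement is large enough for local estimates to propagate.\<close>

definition straight :: "real \<Rightarrow> 'a \<Rightarrow> bool" where
  "straight c g \<longleftrightarrow> g \<in> carrier G \<and> gp g (inv g) \<le> c \<and> 2 * c + 3 * \<delta> + 1 \<le> len g"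

section \<open>Straight elements, their powers and their centralizers\<close>

lemma straight_inv: "straight c g \<Longrightarrow> straight c (inv g)"
  by (auto simp: straight_def gp_commute)

lemma straight_nonneg: "straight c g \<Longrightarrow> c \<ge> 0"
  unfolding straight_def using gp_nonneg inv_closed order_trans by blast

text \<open>Translated by \<open>inv g\<close>, the induction hypothesis says that
  \<open>inv (g [^] Suc n)\<close> follows \<open>inv g\<close> up to a last piece of length
  \<open>c + \<delta>\<close>. As \<open>inv g\<close> is long and leaves \<open>g\<close> early, so
  does this power.\<close>

lemma gp_straight_pow_inv:
  assumes "straight c g"
  shows "gp g (inv (g [^] (n::nat))) \<le> c + \<delta>"
proof (induction n)
  case 0
  then show ?case
    using assms straight_nonneg [OF assms] delta_nonneg by (simp add: straight_def)
next
  case (Suc n)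
  have g: "g \<in> carrier G" "gp g (inv g) \<le> c" "2 * c + 3 * \<delta> + 1 \<le> len g"
    using assms by (auto simp: straight_def)
  let ?y = "inv (g [^] Suc n)"
  have "inv (inv g) \<otimes> ?y = inv (g [^] n)"
    using g by (simp add: inv_mult_group)
  then have "gp (inv g) ?y = len g - gp g (inv (g [^] n))"
    using gp_add_gp_inv [of "inv g" ?y] g by simp
  then have far: "gp ?y (inv g) \<ge> len g - (c + \<delta>)"
    using Suc.IH g by (simp add: gp_commute)
  show ?case
    using gp_le_of_gp_gt [of g ?y "inv g" c] g far delta_nonneg by simp
qed

text \<open>Each further factor adds at least \<open>len g - 2 * (c + \<delta>)\<close>, which the
  displacement bound in \<open>straight\<close> keeps above 1 or equal to it.\<close>

lemma len_straight_pow: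
  assumes "straight c g"
  shows "n \<le> len (g [^] (n::nat))"
proof (induction n)
  case (Suc n)
  have g: "g \<in> carrier G" "2 * c + 3 * \<delta> + 1 \<le> len g"
    using assms by (auto simp: straight_def)
  have "gp (inv (g [^] n)) g \<le> c + \<delta>"
    using gp_straight_pow_inv [OF assms] g by (simp add: gp_commute)
  then have "real (len (g [^] Suc n)) \<ge> len (g [^] n) + 1"
    using g delta_nonneg by (simp add: gp_def)
  then show ?case
    using Suc by simp
qed simp

text \<open>Positive powers start in the direction of \<open>g\<close>, which the inverse powers
  leave early; comparing them costs one more \<delta>.\<close>

lemma gp_straight_pow_pow_inv:
  assumes "straight c g"
  shows "gp (g [^] (a::nat)) (inv (g [^] (b::nat))) \<le> c + 2 * \<delta>"
proof (cases a)
  case 0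
  then show ?thesis
    using assms straight_nonneg [OF assms] delta_nonneg by (simp add: straight_def)
next
  case (Suc k)
  have g: "g \<in> carrier G" "2 * c + 3 * \<delta> + 1 \<le> len g"
    using assms by (auto simp: straight_def)
  have "gp (inv g) (g [^] k) \<le> c + \<delta>"
    using gp_straight_pow_inv [OF straight_inv [OF assms], of k] g
    by (simp add: nat_pow_inv)
  moreover have "inv g \<otimes> g [^] a = g [^] k"
    unfolding Suc nat_pow_Suc_left [OF g(1)] using g by simp
  ultimately have "gp g (g [^] a) \<ge> len g - (c + \<delta>)"
    using gp_add_gp_inv [of g "g [^] a"] g by simp
  then have "gp (inv (g [^] b)) (g [^] a) \<le> (c + \<delta>) + \<delta>"
    using gp_le_of_gp_gt [of "inv (g [^] b)" "g [^] a" g "c + \<delta>"]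
      gp_straight_pow_inv [OF assms, of b] g by (simp add: gp_commute)
  then show ?thesis
    using g by (simp add: gp_commute)
qed

text \<open>Take a high power of \<open>g\<close> for \<open>y\<close>. Since \<open>y\<close> and
  \<open>inv y\<close> diverge, no \<open>h\<close> can follow both. One \<open>y\<close> serves the
  whole centralizer, as the count in \<open>card_centralizer_straight_le\<close> requires.\<close>

lemma centralizer_far_point:
  fixes R :: real
  assumes "straight c g"
  obtains y where "y \<in> carrier G" "R < len y" "\<And>h. h \<in> centralizer g \<Longrightarrow> h \<otimes> y = y \<otimes> h"
    "\<And>h. h \<in> centralizer g \<Longrightarrow> gp h y \<le> c + 3 * \<delta> \<or> gp h (inv y) \<le> c + 3 * \<delta>"
proof -
  have g: "g \<in> carrier G"
    using assms by (auto simp: straight_def)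
  obtain N :: nat where N: "R < N"
    using reals_Archimedean2 by blast
  show ?thesis
  proof
    show "g [^] N \<in> carrier G"
      using g by simp
    show "R < len (g [^] N)"
      using N len_straight_pow [OF assms, of N] by simp
    fix h assume h: "h \<in> centralizer g"
    then have hG: "h \<in> carrier G"
      by (simp add: centralizer_def)
    show "h \<otimes> g [^] N = g [^] N \<otimes> h"
      using h g pow_mult_distrib [of g h] group_commutes_pow [of g h N]
      by (simp add: centralizer_def)
    show "gp h (g [^] N) \<le> c + 3 * \<delta> \<or> gp h (inv (g [^] N)) \<le> c + 3 * \<delta>"
      using gp_le_of_gp_gt [of "g [^] N" h "inv (g [^] N)" "c + 2 * \<delta>"] g hG
        gp_straight_pow_pow_inv [OF assms, of N N] by (auto simp: gp_commute not_le)
  qed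
qed

text \<open>Since \<open>h\<close> commutes with \<open>y\<close>, the products of \<open>h\<close> with \<open>inv y\<close> and of \<open>inv h\<close> with \<open>y\<close>
  agree: the translation \<open>h\<close> moves towards \<open>y\<close> as soon as it does not move towards \<open>inv y\<close>.\<close>

lemma gp_ge_of_commute:
  fixes e :: real
  assumes "h \<in> carrier G" "y \<in> carrier G" "h \<otimes> y = y \<otimes> h"
    and "gp h (inv y) \<le> e" "len h + e + \<delta> < len y"
  shows "gp h y \<ge> len h - e - \<delta>"
proof -
  have "inv (inv h \<otimes> y) \<otimes> y = h"
    using assms(1,2) by (simp add: inv_mult_group m_assoc assms(3))
  then have "gp (inv h \<otimes> y) y = (real (len (inv h \<otimes> y)) + len y - len h) / 2"
    by (simp add: gp_def)
  moreover have "len y \<le> len h + len (inv h \<otimes> y)"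
    using len_mult_le [of h "inv h \<otimes> y"] assms by simp
  ultimately have "gp (inv h \<otimes> y) y > e + \<delta>"
    using assms(5) by simp
  moreover have "gp (inv h) y \<le> e"
    using assms by (simp add: gp_inv_left)
  ultimately have "gp (inv h) (inv h \<otimes> y) \<le> e + \<delta>"
    using gp_le_of_gp_gt [of "inv h" "inv h \<otimes> y" y e] assms by simp
  then show ?thesis
    using gp_add_gp_inv [of h y] assms by simp
qed

text \<open>If \<open>h\<close> moves towards one of the far points \<open>y\<close> and
  \<open>inv y\<close>, then \<open>inv h\<close> does not, so \<open>h\<close> and
  \<open>inv h\<close> diverge. The far point contributes \<open>3 * \<delta>\<close> to the loss,
  the last comparison one more \<delta>.\<close>

lemma straight_of_mem_centralizer:
  assumes "straight c g" "h \<in> centralizer g" "2 * (c + 4 * \<delta>) + 3 * \<delta> + 1 \<le> len h"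
  shows "straight (c + 4 * \<delta>) h"
proof -
  let ?e = "c + 3 * \<delta>"
  have h: "h \<in> carrier G"
    using assms by (simp add: centralizer_def)
  \<comment> \<open>Stated for a general \<open>z\<close>, since either \<open>y\<close> or
    \<open>inv y\<close> may be the point towards which \<open>h\<close> moves.\<close>
  have main: "gp h (inv h) \<le> ?e + \<delta>"
    if z: "z \<in> carrier G" "h \<otimes> z = z \<otimes> h" "len h + ?e + \<delta> < len z" "gp h (inv z) \<le> ?e" for z
  proof -
    have "gp h z \<ge> len h - ?e - \<delta>"
      using gp_ge_of_commute [of h z ?e] h z by simp
    moreover have "gp (inv h) z \<le> ?e"
      using z h by (simp add: gp_inv_left)
    ultimately have "gp (inv h) h \<le> ?e + \<delta>"
      using gp_le_of_gp_gt [of "inv h" h z ?e] z h assms(3) delta_nonneg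
      by simp
    then show ?thesis
      using h by (simp add: gp_commute)
  qed
  obtain y where y: "y \<in> carrier G" "len h + ?e + \<delta> < len y" "h \<otimes> y = y \<otimes> h"
    "gp h y \<le> ?e \<or> gp h (inv y) \<le> ?e"
    using centralizer_far_point [OF assms(1), of "len h + ?e + \<delta>"] assms(2) by metis
  have "h \<otimes> inv y = inv y \<otimes> h"
    using y h inv_commute [of y h] by simp
  then have "gp h (inv h) \<le> ?e + \<delta>"
    using main [of y] main [of "inv y"] y by auto
  then show ?thesis
    using h assms by (simp add: straight_def)
qed

text \<open>Sort the elements by length and by the far point they move towards. Elements of one
  group follow the same geodesic almost to their ends, so they are boundedly close to each other.
  There are two directions and \<open>n + 1\<close> lengths.\<close>

lemma card_centralizer_straight_le:
  assumes "straight c g"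
  shows "card (centralizer g \<inter> ball n) \<le> 2 * (n + 1) * card (ball (nat \<lceil>2 * c + 10 * \<delta>\<rceil>))"
proof -
  let ?e = "c + 3 * \<delta>" and ?B = "ball (nat \<lceil>2 * c + 10 * \<delta>\<rceil>)"
  obtain y where y: "y \<in> carrier G" "n + ?e + \<delta> < len y"
    and comm: "\<And>h. h \<in> centralizer g \<Longrightarrow> h \<otimes> y = y \<otimes> h"
    and dich: "\<And>h. h \<in> centralizer g \<Longrightarrow> gp h y \<le> ?e \<or> gp h (inv y) \<le> ?e"
    using centralizer_far_point [OF assms, of "n + ?e + \<delta>"] by metis
  \<comment> \<open>The condition only says that \<open>h\<close> does not move towards
    \<open>inv z\<close>; that it moves towards \<open>z\<close> then follows from
    \<open>gp_ge_of_commute\<close>.\<close>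
  define P where "P z j = {h \<in> centralizer g. len h = j \<and> gp h (inv z) \<le> ?e}" for z j
  have P_closed: "P z j \<subseteq> carrier G" for z j
    by (auto simp: P_def centralizer_def)
  have card_P: "card (P z j) \<le> card ?B"
    if z: "z \<in> carrier G" "len z = len y" "\<And>h. h \<in> centralizer g \<Longrightarrow> h \<otimes> z = z \<otimes> h"
      and j: "j \<le> n" for z j
  proof (cases "P z j = {}")
    case False
    then obtain h where h: "h \<in> P z j" by blast
    have gp_z: "gp k z \<ge> j - ?e - \<delta>" if "k \<in> P z j" for k
      using gp_ge_of_commute [of k z ?e] that z j y P_closed
      by (auto simp: P_def centralizer_def)
    have "(\<lambda>k. inv h \<otimes> k) ` P z j \<subseteq> ?B"
    proof clarify
      fix k assume k: "k \<in> P z j"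
      have G: "h \<in> carrier G" "k \<in> carrier G"
        using h k P_closed by auto
      have "gp h k \<ge> (j - ?e - \<delta>) - \<delta>"
        using gp_hyperbolic [of h z k "j - ?e - \<delta>"] gp_z [OF h] gp_z [OF k] G z
        by (simp add: gp_commute)
      \<comment> \<open>Both elements have length \<open>j\<close>, so their distance is at most
        \<open>2 * (?e + 2 * \<delta>)\<close>, which is the radius of \<open>?B\<close>.\<close>
      then have "real (len (inv h \<otimes> k)) \<le> 2 * c + 10 * \<delta>"
        using h k by (simp add: gp_def P_def)
      then have "len (inv h \<otimes> k) \<le> nat \<lceil>2 * c + 10 * \<delta>\<rceil>"
        by linarith
      then show "inv h \<otimes> k \<in> ?B"
        using G by (simp add: mem_ball_iff)
    qed
    moreover have "inj_on (\<lambda>k. inv h \<otimes> k) (P z j)"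
      using h P_closed by (intro inj_onI) (metis mult_inv_cancel subsetD)
    ultimately show ?thesis
      using card_inj_on_le finite_ball by blast
  qed simp
  have comm_inv: "h \<otimes> inv y = inv y \<otimes> h" if "h \<in> centralizer g" for h
    using inv_commute [of y h] comm [OF that] that y by (simp add: centralizer_def)
  have fin: "finite (P z j)" for z j
    by (rule finite_subset [OF _ finite_ball [of j]]) (auto simp: P_def centralizer_def mem_ball_iff)
  have "centralizer g \<inter> ball n \<subseteq> (\<Union>j\<in>{..n}. P y j \<union> P (inv y) j)"
  proof
    fix h assume "h \<in> centralizer g \<inter> ball n"
    then have "len h \<in> {..n}" "h \<in> P y (len h) \<union> P (inv y) (len h)"
      using dich [of h] y by (auto simp: P_def mem_ball_iff)
    then show "h \<in> (\<Union>j\<in>{..n}. P y j \<union> P (inv y) j)"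
      by blast
  qed
  then have "card (centralizer g \<inter> ball n) \<le> card (\<Union>j\<in>{..n}. P y j \<union> P (inv y) j)"
    using fin by (intro card_mono) auto
  also have "\<dots> \<le> (\<Sum>j\<in>{..n}. card (P y j \<union> P (inv y) j))"
    by (rule card_UN_le) simp
  also have "\<dots> \<le> (\<Sum>j\<in>{..n}. 2 * card ?B)"
  proof (rule sum_mono)
    fix j assume "j \<in> {..n}"
    then have "card (P y j) \<le> card ?B" "card (P (inv y) j) \<le> card ?B"
      using card_P [of y j] card_P [of "inv y" j] y comm comm_inv by auto
    then show "card (P y j \<union> P (inv y) j) \<le> 2 * card ?B"
      using card_Un_le [of "P y j" "P (inv y) j"] by linarith
  qed
  finally show ?thesis
    by (simp add: algebra_simps)
qed

text \<open>If the two ends of a geodesic word for \<open>g\<close> fellow-travelled for long, a cyclic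
  permutation of the word would represent a shorter conjugate.\<close>

lemma straight_of_minimal:
  assumes g: "g \<in> carrier G" and min: "\<And>h. h \<in> conj_class g \<Longrightarrow> len g \<le> len h"
    and large: "7 * \<delta> + 3 \<le> len g"
  shows "straight (2 * \<delta> + 1) g"
proof -
  \<comment> \<open>The least integer above \<open>2 * \<delta>\<close>: strictness gives the final
    contradiction, and \<open>k \<le> 2 * \<delta> + 1\<close> gives the constant of
    straightness.\<close>
  define k where "k = nat \<lfloor>2 * \<delta>\<rfloor> + 1"
  have k: "2 * \<delta> < k" "k \<le> 2 * \<delta> + 1"
    unfolding k_def using delta_nonneg by linarith+
  have len_k: "2 * k \<le> len g"
    using k large delta_nonneg by linarith
  obtain u where u: "u \<in> carrier G" "len u = k" "len (inv u \<otimes> g) = len g - k"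
    using geodesic_split [of g k] g len_k by auto
  obtain v where v: "v \<in> carrier G" "len v = len (inv u \<otimes> g) - k" "len (inv v \<otimes> (inv u \<otimes> g)) = len (inv u \<otimes> g) - (len (inv u \<otimes> g) - k)"
    by (rule geodesic_split [OF m_closed [OF inv_closed [OF u(1)] g] diff_le_self])
  define w where "w = inv v \<otimes> (inv u \<otimes> g)"
  have w: "w \<in> carrier G" "len w = k" "g = u \<otimes> (v \<otimes> w)"
    using u v g len_k by (auto simp: w_def)
  \<comment> \<open>The cyclic permutation of \<open>u\<close>, \<open>v\<close>, \<open>w\<close>;
    minimality of \<open>g\<close> then forbids cancellation between \<open>w\<close> and
    \<open>u\<close>.\<close>
  have "v \<otimes> (w \<otimes> u) = inv u \<otimes> g \<otimes> inv (inv u)"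
    using u v w by (simp add: m_assoc)
  then have "v \<otimes> (w \<otimes> u) \<in> conj_class g"
    using u unfolding mem_conj_class_iff by blast
  then have "len g \<le> len v + len (w \<otimes> u)"
    using min len_mult_le [of v "w \<otimes> u"] u v w by fastforce
  then have wu: "2 * k \<le> len (w \<otimes> u)"
    using v u len_k by simp
  have "gp g (inv g) < k"
  proof (rule ccontr)
    assume "\<not> ?thesis"
    then have *: "gp g (inv g) \<ge> k" by simp
    \<comment> \<open>In the chain \<open>u\<close>, \<open>g\<close>, \<open>inv g\<close>,
      \<open>inv w\<close> consecutive products are at least \<open>k\<close>. Two uses of
      hyperbolicity put \<open>u\<close> and \<open>inv w\<close> within
      \<open>4 * \<delta>\<close>, against \<open>wu\<close>.\<close>
    have "gp u g = k"
      using u len_k by (simp add: gp_def of_nat_diff)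
    then have "gp u (inv g) \<ge> k - \<delta>"
      using gp_hyperbolic [of u g "inv g" k] * u g by simp
    moreover have "gp (inv g) (inv w) = k"
    proof -
      have "g \<otimes> inv w = u \<otimes> v"
        using u v w by (simp add: m_assoc)
      moreover have "inv (u \<otimes> v) = w \<otimes> inv g"
        using u v w by (simp add: inv_mult_group m_assoc [symmetric])
      moreover have "len (u \<otimes> v) = len g - k"
      proof (rule antisym)
        show "len (u \<otimes> v) \<le> len g - k"
          using len_mult_le [of u v] u v len_k by simp
        show "len g - k \<le> len (u \<otimes> v)"
          using len_mult_le [of "u \<otimes> v" w] u v w by (simp add: m_assoc)
      qed
      ultimately show ?thesis
        using w g len_k by (simp add: gp_def of_nat_diff)
    qed
    ultimately have "gp u (inv w) \<ge> k - \<delta> - \<delta>"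
      using gp_hyperbolic [of u "inv g" "inv w" "k - \<delta>"] u g w delta_nonneg by simp
    moreover have "len (inv u \<otimes> inv w) = len (w \<otimes> u)"
      using u w len_inv [of "w \<otimes> u"] by (simp add: inv_mult_group)
    ultimately have "len (w \<otimes> u) \<le> 4 * \<delta>"
      using u w by (simp add: gp_def)
    then show False
      using wu k by linarith
  qed
  then show ?thesis
    using g k large by (simp add: straight_def)
qed

end

section \<open>Counting conjugacy classes\<close>

lemma (in group) infinite_rcosets_of_not_virtually_cyclic:
  assumes "\<not> virtually_cyclic G" "g \<in> carrier G"
  shows "infinite (rcosets (generate G {g}))"
proof
  assume "finite (rcosets (generate G {g}))"
  moreover have "cyclic_group (G\<lparr>carrier := generate G {g}\<rparr>)"
    using cyclic_group_generated [of g] assms(2) by (simp add: subgroup_generated_def)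
  ultimately have "virtually_cyclic G"
    unfolding virtually_cyclic_def using generate_is_subgroup [of "{g}"] assms(2) by blast
  then show False
    using assms by simp
qed

lemma (in group) infinite_carrier_of_not_virtually_cyclic:
  assumes "\<not> virtually_cyclic G"
  shows "infinite (carrier G)"
proof
  assume "finite (carrier G)"
  then have "finite (rcosets (generate G {\<one>}))"
    by (simp add: RCOSETS_def)
  then show False
    using infinite_rcosets_of_not_virtually_cyclic [OF assms] by blast
qed

lemma card_fibre_gt:
  assumes "finite A" "card (f ` A) * m < card A"
  obtains a where "a \<in> A" "m < card {x \<in> A. f x = f a}"
proof -
  have "\<exists>a\<in>A. m < card {x \<in> A. f x = f a}"
  proof (rule ccontr)
    assume "\<not> ?thesis"
    then have small: "card {x \<in> A. f x = y} \<le> m" if "y \<in> f ` A" for y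
      using that by (auto simp: not_less)
    have "card A \<le> card (\<Union>y\<in>f ` A. {x \<in> A. f x = y})"
      using assms by (intro card_mono) auto
    also have "\<dots> \<le> (\<Sum>y\<in>f ` A. card {x \<in> A. f x = y})"
      using assms by (intro card_UN_le) auto
    also have "\<dots> \<le> card (f ` A) * m"
      using sum_mono [OF small] by simp
    finally show False
      using assms by simp
  qed
  then show ?thesis
    using that by blast
qed

section \<open>Growth of balls and sizes of conjugacy classes\<close>

context word_metric
begin

text \<open>Each chosen coset of the subgroup generated by \<open>g\<close> puts linearly many
  elements \<open>g [^] i \<otimes> a c\<close> into the ball. Cosets are disjoint, so taking enough
  of them beats any given linear rate.\<close>

lemma superlinear_growth:
  assumes g: "g \<in> carrier G" and inj: "inj (\<lambda>n::nat. g [^] n)"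
    and inf: "infinite (rcosets (generate G {g}))"
  shows "\<forall>\<^sub>F n in sequentially. A * (n + 1) \<le> card (ball n)"
proof -
  let ?H = "generate G {g}"
  \<comment> \<open>The summand 1 makes \<open>l\<close> positive, as the division by
    \<open>l\<close> below needs.\<close>
  define l where "l = len g + 1"
  \<comment> \<open>The factor \<open>l\<close> makes up for the length of \<open>g\<close>, the
    factor 2 for the radius \<open>r\<close> of the coset representatives.\<close>
  obtain F where F: "F \<subseteq> rcosets ?H" "finite F" "card F = 2 * A * l"
    using infinite_arbitrarily_large [OF inf] by blast
  have H: "subgroup ?H G"
    using g by (intro generate_is_subgroup) auto
  have "\<forall>c\<in>F. \<exists>a\<in>carrier G. c = ?H #> a"
    using F by (auto simp: RCOSETS_def)
  then obtain a where a: "\<And>c. c \<in> F \<Longrightarrow> a c \<in> carrier G" "\<And>c. c \<in> F \<Longrightarrow> c = ?H #> a c"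
    by metis
  obtain r where r: "a ` F \<subseteq> ball r"
    using finite_subset_ball [of "a ` F"] F a by blast
  have pow_H: "g [^] (i::nat) \<in> ?H" for i
    by (induction i) (auto intro: generate.intros subgroup.m_closed [OF H])
  have large: "card F * (q + 1) \<le> card (ball (q * l + r))" for q
  proof -
    have mem: "g [^] i \<otimes> a c \<in> c" if "c \<in> F" for i :: nat and c
      using a(2) [OF that] pow_H [of i] by (metis UN_I insertI1 r_coset_def)
    have "inj_on (\<lambda>(i, c). g [^] i \<otimes> a c) ({..q} \<times> F)"
    proof (rule inj_onI)
      fix p p' assume p: "p \<in> {..q} \<times> F" "p' \<in> {..q} \<times> F"
        "(\<lambda>(i, c). g [^] i \<otimes> a c) p = (\<lambda>(i, c). g [^] i \<otimes> a c) p'"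
      obtain i c j d where eq: "p = (i, c)" "p' = (j, d)"
        by (metis surj_pair)
      then have *: "c \<in> F" "d \<in> F" "g [^] i \<otimes> a c = g [^] j \<otimes> a d"
        using p by auto
      then have "c \<inter> d \<noteq> {}"
        using mem [of c i] mem [of d j] by auto
      then have "c = d"
        using rcos_disjoint [OF H] F * by (auto simp: pairwise_def disjnt_def)
      then have "g [^] i = g [^] j"
        using * a g by simp
      then show "p = p'"
        using inj \<open>c = d\<close> eq by (simp add: inj_eq)
    qed
    moreover have "(\<lambda>(i, c). g [^] i \<otimes> a c) ` ({..q} \<times> F) \<subseteq> ball (q * l + r)"
    proof clarsimp
      fix i :: nat and c assume i: "i \<le> q" and c: "c \<in> F"
      have "len (g [^] i \<otimes> a c) \<le> len (g [^] i) + len (a c)"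
        using g a c by (simp add: len_mult_le)
      also have "\<dots> \<le> q * l + r"
      proof (rule add_mono)
        show "len (g [^] i) \<le> q * l"
          using len_pow_le [OF g, of i] i mult_le_mono [of i q "len g" l]
          by (simp add: l_def)
        show "len (a c) \<le> r"
          using r c by (auto simp: mem_ball_iff)
      qed
      finally show "g [^] i \<otimes> a c \<in> ball (q * l + r)"
        using g a c by (simp add: mem_ball_iff)
    qed
    ultimately have "card ({..q} \<times> F) \<le> card (ball (q * l + r))"
      using card_inj_on_le finite_ball by blast
    then show ?thesis
      by (simp add: card_cartesian_product mult.commute)
  qed
  \<comment> \<open>The threshold is what gives \<open>n + 1 \<le> 2 * (n - r)\<close>.\<close>
  have "A * (n + 1) \<le> card (ball n)" if n: "2 * r + 1 \<le> n" for n
  proof -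
    define q where "q = (n - r) div l"
    have "q * l \<le> n - r"
      by (simp add: q_def)
    then have "ball (q * l + r) \<subseteq> ball n"
      using n by (auto simp: mem_ball_iff)
    then have "card (ball (q * l + r)) \<le> card (ball n)"
      by (intro card_mono) auto
    then have "2 * A * l * (q + 1) \<le> card (ball n)"
      using large [of q] F by simp
    moreover have "n - r \<le> (q + 1) * l"
      using dividend_less_div_times [of l "n - r"] by (simp add: q_def l_def)
    then have "A * (n + 1) \<le> A * (2 * ((q + 1) * l))"
      using n by (intro mult_le_mono) auto
    ultimately show ?thesis
      by (simp add: algebra_simps)
  qed
  then show ?thesis
    by (auto simp: eventually_sequentially)
qed

lemma ball_unbounded:
  assumes "infinite (carrier G)"
  shows "\<forall>\<^sub>F n in sequentially. A \<le> card (ball n)"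
proof -
  obtain F where F: "F \<subseteq> carrier G" "finite F" "card F = A"
    using infinite_arbitrarily_large [OF assms] by blast
  obtain r where r: "F \<subseteq> ball r"
    using finite_subset_ball F by blast
  have "A \<le> card (ball n)" if "r \<le> n" for n
  proof -
    have "F \<subseteq> ball n"
      using r that by (auto simp: mem_ball_iff)
    then show ?thesis
      using F card_mono [of "ball n" F] by simp
  qed
  then show ?thesis
    by (auto simp: eventually_sequentially)
qed

lemma conjugacy_ball_eq: "conjugacy_ball G X n = conj_class ` ball n"
proof (intro equalityI subsetI)
  fix c assume "c \<in> conjugacy_ball G X n"
  then obtain x g where "x \<in> carrier G" "c = conj_class x" "g \<in> c" "g \<in> ball n"
    by (auto simp: conjugacy_ball_def conjugacy_classes_eq)
  then show "c \<in> conj_class ` ball n"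
    using conj_class_eq by blast
next
  fix c assume "c \<in> conj_class ` ball n"
  then show "c \<in> conjugacy_ball G X n"
    using conj_class_self by (auto simp: conjugacy_ball_def conjugacy_classes_eq mem_ball_iff)
qed

text \<open>Classes are disjoint, so the elements that each of them contributes to the ball are
  counted once.\<close>

lemma card_crowded_classes_le:
  "K * card {c \<in> conjugacy_ball G X n. K \<le> card (c \<inter> ball n)} \<le> card (ball n)"
proof -
  let ?F = "{c \<in> conjugacy_ball G X n. K \<le> card (c \<inter> ball n)}"
  have fin: "finite ?F"
    by (simp add: conjugacy_ball_eq)
  have disj: "c \<inter> ball n \<inter> (d \<inter> ball n) = {}" if "c \<in> ?F" "d \<in> ?F" "c \<noteq> d" for c d
  proof (rule ccontr)
    assume "\<not> ?thesis"
    then obtain x where x: "x \<in> c" "x \<in> d"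
      by blast
    obtain g h where "g \<in> carrier G" "c = conj_class g" "h \<in> carrier G" "d = conj_class h"
      using \<open>c \<in> ?F\<close> \<open>d \<in> ?F\<close> by (auto simp: conjugacy_ball_eq mem_ball_iff)
    then have "conj_class x = c" "conj_class x = d"
      using x conj_class_eq [of g x] conj_class_eq [of h x] by simp_all
    then show False
      using \<open>c \<noteq> d\<close> by simp
  qed
  have "K * card ?F = (\<Sum>c\<in>?F. K)"
    by simp
  also have "\<dots> \<le> (\<Sum>c\<in>?F. card (c \<inter> ball n))"
    by (intro sum_mono) auto
  also have "\<dots> = card (\<Union>c\<in>?F. c \<inter> ball n)"
    using fin disj by (intro card_UN_disjoint [symmetric]) auto
  also have "\<dots> \<le> card (ball n)"
    by (intro card_mono) auto
  finally show ?thesis .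
qed

text \<open>The conjugates of \<open>g\<close> by the prefixes \<open>u i\<close> of a geodesic word are no longer than \<open>g\<close>.
  If many of them coincide, the corresponding quotients of prefixes are distinct, because
  the prefixes have distinct lengths, and they centralize the common conjugate.\<close>

lemma many_commuting_elements:
  assumes g: "g \<in> ball n" "K * m \<le> len g" and few: "card (conj_class g \<inter> ball n) < K"
  obtains h W where "h \<in> conj_class g" "h \<in> ball n"
    "W \<subseteq> centralizer h \<inter> ball (2 * (K * m))" "m < card W"
proof -
  let ?L = "K * m"
  have gG: "g \<in> carrier G" "len g \<le> n"
    using g by (auto simp: mem_ball_iff)
  have "\<exists>u. u \<in> carrier G \<and> len u = i \<and> len (inv u \<otimes> g) = len g - i" if "i \<le> ?L" for i
    using geodesic_split [of g i] gG g that by (metis le_trans)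
  then obtain u where u: "\<And>i. i \<le> ?L \<Longrightarrow> u i \<in> carrier G" "\<And>i. i \<le> ?L \<Longrightarrow> len (u i) = i"
    "\<And>i. i \<le> ?L \<Longrightarrow> len (inv u i \<otimes> g) = len g - i"
    by metis
  define f where "f i = inv u i \<otimes> g \<otimes> u i" for i
  have f: "f i \<in> conj_class g \<inter> ball n" if "i \<le> ?L" for i
  proof
    have "f i = inv u i \<otimes> g \<otimes> inv (inv u i)"
      using u that by (simp add: f_def)
    then show "f i \<in> conj_class g"
      using u that unfolding mem_conj_class_iff by blast
    \<comment> \<open>The prefix adds back at most the \<open>i\<close> letters that were cut
      off.\<close>
    have "len (f i) \<le> len g"
      using len_mult_le [of "inv u i \<otimes> g" "u i"] u [OF that] g(2) gG that by (simp add: f_def)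
    then show "f i \<in> ball n"
      using u that gG by (simp add: mem_ball_iff f_def)
  qed
  have "card (f ` {..?L}) \<le> card (conj_class g \<inter> ball n)"
    using f by (intro card_mono) auto
  then have "card (f ` {..?L}) * m \<le> K * m"
    using few by (intro mult_le_mono1) simp
  \<comment> \<open>Pigeonhole: there are \<open>K * m + 1\<close> indices and fewer than
    \<open>K\<close> values.\<close>
  then have "card (f ` {..?L}) * m < card {..?L}"
    by (simp only: card_atMost less_Suc_eq_le)
  then obtain j where "j \<in> {..?L}" and fibre: "m < card {i \<in> {..?L}. f i = f j}"
    using card_fibre_gt [OF finite_atMost] by metis
  then have j: "j \<le> ?L"
    by simp
  let ?I = "{i \<in> {..?L}. f i = f j}"
  show ?thesis
  proof
    show "f j \<in> conj_class g" "f j \<in> ball n"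
      using f [OF j] by auto
    show "(\<lambda>i. inv u j \<otimes> u i) ` ?I \<subseteq> centralizer (f j) \<inter> ball (2 * ?L)"
    proof (rule image_subsetI)
      fix i assume "i \<in> ?I"
      then have i: "i \<le> ?L" "f i = f j"
        by auto
      have G: "u i \<in> carrier G" "u j \<in> carrier G"
        using u i j by auto
      \<comment> \<open>Both sides equal \<open>inv u j \<otimes> g \<otimes> u i\<close>.\<close>
      have "(inv u j \<otimes> u i) \<otimes> f i = f j \<otimes> (inv u j \<otimes> u i)"
        using G gG by (simp add: f_def m_assoc)
      then have "inv u j \<otimes> u i \<in> centralizer (f j)"
        using i G by (simp add: centralizer_def)
      moreover have "len (inv u j \<otimes> u i) \<le> 2 * ?L"
        using len_mult_le [of "inv u j" "u i"] G u(2) i j by simp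
      ultimately show "inv u j \<otimes> u i \<in> centralizer (f j) \<inter> ball (2 * ?L)"
        using G by (simp add: mem_ball_iff)
    qed
    have "inj_on (\<lambda>i. inv u j \<otimes> u i) ?I"
    proof (rule inj_onI)
      fix i k assume *: "i \<in> ?I" "k \<in> ?I" "inv u j \<otimes> u i = inv u j \<otimes> u k"
      then have "u i = u k"
        using u j by simp
      then show "i = k"
        using u(2) * by (metis (no_types, lifting) atMost_iff mem_Collect_eq)
    qed
    then show "m < card ((\<lambda>i. inv u j \<otimes> u i) ` ?I)"
      using fibre by (simp add: card_image)
  qed
qed

end

section \<open>Loxodromic elements in centralizers\<close>

context hyperbolic_word_metric
begin

text \<open>A shortest conjugate of \<open>g\<close> lies outside the ball, so it is long enough for
  \<open>straight_of_minimal\<close>.\<close>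

lemma straight_conj_of_far:
  assumes "g \<in> carrier G" "conj_class g \<inter> ball (nat \<lceil>7 * \<delta> + 3\<rceil>) = {}"
  obtains p where "p \<in> carrier G" "straight (2 * \<delta> + 1) (p \<otimes> g \<otimes> inv p)"
proof -
  obtain h where h: "h \<in> conj_class g" "\<And>k. k \<in> conj_class h \<Longrightarrow> len h \<le> len k"
    using ex_minimal_conj [OF assms(1)] by blast
  have hG: "h \<in> carrier G"
    using h assms conj_class_closed by blast
  moreover have "h \<notin> ball (nat \<lceil>7 * \<delta> + 3\<rceil>)"
    using assms h by blast
  ultimately have "\<not> len h \<le> nat \<lceil>7 * \<delta> + 3\<rceil>"
    unfolding mem_ball_iff by blast
  then have "7 * \<delta> + 3 \<le> len h"
    by linarith
  then have "straight (2 * \<delta> + 1) h"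
    using straight_of_minimal hG h by blast
  then show ?thesis
    using that h by (auto simp: mem_conj_class_iff)
qed

text \<open>A quantitative form of the usual notion: the powers of a straight conjugate escape
  linearly. The constant is the one that \<open>straight_of_mem_centralizer\<close> produces from
  \<open>2 * \<delta> + 1\<close>.\<close>

definition loxodromic :: "'a \<Rightarrow> bool" where
  "loxodromic v \<longleftrightarrow> (\<exists>p\<in>carrier G. straight (6 * \<delta> + 1) (p \<otimes> v \<otimes> inv p))"

text \<open>Conjugate \<open>g\<close> to a straight element. The conjugated \<open>W\<close> is too
  large for the ball, and an element of it outside the ball is a long element of the centralizer of
  a straight one.\<close>

lemma ex_loxodromic_in_centralizer:
  assumes g: "g \<in> carrier G" "conj_class g \<inter> ball (nat \<lceil>7 * \<delta> + 3\<rceil>) = {}"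
    and W: "W \<subseteq> centralizer g" "card (ball (nat \<lceil>15 * \<delta> + 3\<rceil>)) < card W"
  shows "\<exists>v\<in>W. loxodromic v"
proof -
  obtain p where p: "p \<in> carrier G" "straight (2 * \<delta> + 1) (p \<otimes> g \<otimes> inv p)"
    using straight_conj_of_far [OF g] .
  let ?f = "\<lambda>v. p \<otimes> v \<otimes> inv p"
  have WG: "W \<subseteq> carrier G"
    using W by (auto simp: centralizer_def)
  have "\<not> ?f ` W \<subseteq> ball (nat \<lceil>15 * \<delta> + 3\<rceil>)"
    using card_inj_on_le [OF inj_on_subset [OF inj_on_conj [OF p(1)] WG]] W(2)
    by (meson finite_ball not_le)
  then obtain v where v: "v \<in> W" "?f v \<notin> ball (nat \<lceil>15 * \<delta> + 3\<rceil>)"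
    by blast
  moreover have "?f v \<in> carrier G"
    using p v WG by auto
  ultimately have "\<not> len (?f v) \<le> nat \<lceil>15 * \<delta> + 3\<rceil>"
    unfolding mem_ball_iff by blast
  \<comment> \<open>The length needed for constant \<open>6 * \<delta> + 1\<close>, namely
    \<open>2 * (6 * \<delta> + 1) + 3 * \<delta> + 1\<close>.\<close>
  then have "15 * \<delta> + 3 \<le> len (?f v)"
    by linarith
  moreover have "?f v \<in> centralizer (?f g)"
    using conj_image_centralizer g W v p by blast
  ultimately have "straight (2 * \<delta> + 1 + 4 * \<delta>) (?f v)"
    using straight_of_mem_centralizer [OF p(2)] by simp
  then show ?thesis
    using v p by (auto simp: loxodromic_def)
qed

section \<open>Sparse classes over an arbitrary generating set\<close>

context
  fixes Y :: "'a set"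
  assumes Y: "finite_generating_set G Y"
begin

interpretation Y: word_metric G Y
  by unfold_locales (rule Y)

text \<open>Conjugation by \<open>p\<close> leads injectively into the centralizer of a straight
  element and adds at most \<open>2 * len p\<close> to lengths; changing the word metric costs a
  factor \<open>C\<close>. Linear growth survives both.\<close>

lemma card_centralizer_loxodromic_le:
  assumes v: "v \<in> carrier G" "loxodromic v"
  shows "\<exists>A. \<forall>n. card (centralizer v \<inter> Y.ball n) \<le> A * (n + 1)"
proof -
  obtain p where p: "p \<in> carrier G" "straight (6 * \<delta> + 1) (p \<otimes> v \<otimes> inv p)"
    using v by (auto simp: loxodromic_def)
  obtain C where C: "\<And>g. g \<in> carrier G \<Longrightarrow> len g \<le> C * Y.len g"
    using len_le_mult_word_length [OF Y] by blast
  let ?f = "\<lambda>h. p \<otimes> h \<otimes> inv p"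
  obtain B where B: "\<And>n. card (centralizer (?f v) \<inter> ball n) \<le> 2 * (n + 1) * B"
    using card_centralizer_straight_le [OF p(2)] by blast
  have "card (centralizer v \<inter> Y.ball n) \<le> 2 * (C + 2 * len p + 1) * B * (n + 1)" for n
  proof -
    let ?m = "C * n + 2 * len p"
    have "?f ` (centralizer v \<inter> Y.ball n) \<subseteq> centralizer (?f v) \<inter> ball ?m"
    proof clarify
      fix h assume h: "h \<in> centralizer v" "h \<in> Y.ball n"
      have hG: "h \<in> carrier G" "Y.len h \<le> n"
        using h by (auto simp: Y.mem_ball_iff)
      have "len (?f h) \<le> len p + len h + len p"
        using len_mult_le [of "p \<otimes> h" "inv p"] len_mult_le [of p h] p hG by simp
      moreover have "len h \<le> C * n"
        using C [OF hG(1)] hG(2) by (meson le_trans mult_le_mono2)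
      ultimately show "?f h \<in> centralizer (?f v) \<inter> ball ?m"
        using conj_image_centralizer [OF v(1) h(1) p(1)] p hG by (simp add: mem_ball_iff)
    qed
    moreover have "inj_on ?f (centralizer v \<inter> Y.ball n)"
      using inj_on_conj [OF p(1)] by (rule inj_on_subset) (auto simp: centralizer_def)
    ultimately have "card (centralizer v \<inter> Y.ball n) \<le> card (centralizer (?f v) \<inter> ball ?m)"
      by (intro card_inj_on_le) auto
    also have "\<dots> \<le> 2 * (?m + 1) * B"
      by (rule B)
    also have "\<dots> \<le> 2 * ((C + 2 * len p + 1) * (n + 1)) * B"
      by (intro mult_le_mono) (auto simp: algebra_simps)
    finally show ?thesis
      by (simp add: algebra_simps)
  qed
  then show ?thesis
    by blast
qed

text \<open>Apart from the classes in \<open>?near\<close>, a sparse class contains some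
  \<open>h\<close> commuting with more than \<open>m\<close> elements of bounded length, one of them
  loxodromic. The set \<open>V\<close> of candidates is finite and independent of
  \<open>n\<close>.\<close>

lemma card_sparse_classes_le:
  "\<exists>A. \<forall>n. card {c \<in> conjugacy_ball G Y n. card (c \<inter> Y.ball n) < K} \<le> A * (n + 1)"
proof -
  define m where "m = card (ball (nat \<lceil>15 * \<delta> + 3\<rceil>))"
  define V where "V = {v \<in> Y.ball (2 * (K * m)). loxodromic v}"
  \<comment> \<open>The exceptions: classes with an element too short over \<open>Y\<close> for the
    prefix argument, or too short over \<open>X\<close> to guarantee a straight conjugate.\<close>
  let ?near = "conj_class ` Y.ball (K * m) \<union> conj_class ` ball (nat \<lceil>7 * \<delta> + 3\<rceil>)"
  have "\<forall>v\<in>V. \<exists>A. \<forall>n. card (centralizer v \<inter> Y.ball n) \<le> A * (n + 1)"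
    using card_centralizer_loxodromic_le by (auto simp: V_def Y.mem_ball_iff)
  then obtain A where A: "\<And>v n. v \<in> V \<Longrightarrow> card (centralizer v \<inter> Y.ball n) \<le> A v * (n + 1)"
    by metis
  have "card {c \<in> conjugacy_ball G Y n. card (c \<inter> Y.ball n) < K}
      \<le> (card ?near + (\<Sum>v\<in>V. A v)) * (n + 1)" for n
  proof -
    let ?U = "\<Union>v\<in>V. centralizer v \<inter> Y.ball n"
    have finV: "finite V"
      by (simp add: V_def)
    have sub: "{c \<in> conjugacy_ball G Y n. card (c \<inter> Y.ball n) < K} \<subseteq> ?near \<union> conj_class ` ?U"
    proof clarify
      fix c assume "c \<in> conjugacy_ball G Y n" and few: "card (c \<inter> Y.ball n) < K"
        and far: "c \<notin> conj_class ` ?U" "c \<notin> conj_class ` ball (nat \<lceil>7 * \<delta> + 3\<rceil>)"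
      then obtain g where g: "g \<in> Y.ball n" "c = conj_class g"
        by (auto simp: Y.conjugacy_ball_eq)
      have gG: "g \<in> carrier G"
        using g by (simp add: Y.mem_ball_iff)
      show "c \<in> conj_class ` Y.ball (K * m)"
      proof (rule ccontr)
        assume "\<not> ?thesis"
        then have "g \<notin> Y.ball (K * m)"
          using g by blast
        then have "K * m \<le> Y.len g"
          using gG by (simp add: Y.mem_ball_iff)
        then obtain h W where h: "h \<in> conj_class g" "h \<in> Y.ball n"
          and W: "W \<subseteq> centralizer h \<inter> Y.ball (2 * (K * m))" "m < card W"
          using Y.many_commuting_elements [of g n K m] g few by blast
        have hG: "h \<in> carrier G" and c: "c = conj_class h"
          using conj_class_closed [OF gG h(1)] conj_class_eq [OF gG h(1)] g by auto
        have "conj_class h \<inter> ball (nat \<lceil>7 * \<delta> + 3\<rceil>) = {}"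
        proof (rule ccontr)
          assume "\<not> ?thesis"
          then obtain x where "x \<in> conj_class h" "x \<in> ball (nat \<lceil>7 * \<delta> + 3\<rceil>)"
            by blast
          then show False
            using far(2) c conj_class_eq [OF hG] by blast
        qed
        then obtain v where v: "v \<in> W" "loxodromic v"
          using ex_loxodromic_in_centralizer [OF hG, of W] W unfolding m_def by blast
        \<comment> \<open>Commutation is read in the other direction: \<open>h\<close> now counts as
          an element of the centralizer of \<open>v\<close>.\<close>
        then have "v \<in> V" "h \<in> centralizer v"
          using W hG by (auto simp: V_def centralizer_def Y.mem_ball_iff)
        then show False
          using far(1) c h by blast
      qed
    qed
    have "finite (?near \<union> conj_class ` ?U)"
      using finV by simp
    then have "card {c \<in> conjugacy_ball G Y n. card (c \<inter> Y.ball n) < K}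
        \<le> card (?near \<union> conj_class ` ?U)"
      using sub by (rule card_mono)
    also have "\<dots> \<le> card ?near + card (conj_class ` ?U)"
      by (rule card_Un_le)
    also have "card (conj_class ` ?U) \<le> card ?U"
      using finV by (intro card_image_le) auto
    also have "\<dots> \<le> (\<Sum>v\<in>V. card (centralizer v \<inter> Y.ball n))"
      using finV by (rule card_UN_le)
    also have "\<dots> \<le> (\<Sum>v\<in>V. A v * (n + 1))"
      using A by (rule sum_mono)
    also have "\<dots> = (\<Sum>v\<in>V. A v) * (n + 1)"
      by (rule sum_distrib_right [symmetric])
    also have "card ?near + (\<Sum>v\<in>V. A v) * (n + 1) \<le> (card ?near + (\<Sum>v\<in>V. A v)) * (n + 1)"
      by simp
    finally show ?thesis
      by simp
  qed
  then show ?thesis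
    by blast
qed

end

end

section \<open>Limit of the conjugacy ratio\<close>

lemma ratio_tendsto_0:
  fixes f b t :: "nat \<Rightarrow> nat"
  assumes pos: "\<And>n. b n > 0"
    and bound: "\<And>K. \<exists>A. \<forall>n. K * f n \<le> b n + A * t n"
    and small: "\<And>A. \<forall>\<^sub>F n in sequentially. A * t n \<le> b n"
  shows "(\<lambda>n. real (f n) / real (b n)) \<longlonglongrightarrow> 0"
proof (rule tendstoI)
  fix e :: real assume e: "e > 0"
  \<comment> \<open>The 2 appears because eventually \<open>K * f n \<le> 2 * b n\<close>.\<close>
  obtain K :: nat where K: "2 / e < K"
    using reals_Archimedean2 by blast
  \<comment> \<open>Here \<open>A\<close> may depend on \<open>K\<close>, since \<open>small\<close>
    absorbs every multiple of \<open>t\<close>.\<close>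
  obtain A where A: "\<And>n. K * f n \<le> b n + A * t n"
    using bound by blast
  show "\<forall>\<^sub>F n in sequentially. dist (real (f n) / real (b n)) 0 < e"
    using small [of A]
  proof eventually_elim
    case (elim n)
    have "K * f n \<le> 2 * b n"
      using elim A [of n] by simp
    then have "real K * real (f n) \<le> 2 * real (b n)"
      by (metis of_nat_le_iff of_nat_mult of_nat_numeral)
    also have "\<dots> < K * e * real (b n)"
      using K e pos [of n] by (simp add: field_simps)
    finally have "real K * real (f n) < real K * (e * real (b n))"
      by (simp add: mult.assoc)
    then have "real (f n) < e * real (b n)"
      by (simp add: mult_less_cancel_left)
    then show ?case
      using pos [of n] by (simp add: field_simps)
  qed
qed

theorem theorem4p1:
  fixes G :: "('a, 'b) monoid_scheme"
  assumes "hyperbolic_group G"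
    and "\<not> virtually_cyclic G"
  shows "\<forall>X. finite_generating_set G X \<longrightarrow> conjugacy_ratio G X = 0"
proof (intro allI impI)
  fix X assume X: "finite_generating_set G X"
  interpret group G
    using assms by (simp add: hyperbolic_group_def)
  obtain S \<delta> where S: "finite_generating_set G S" and "\<delta> \<ge> 0"
    and "\<forall>p\<in>carrier G. \<forall>x\<in>carrier G. \<forall>y\<in>carrier G. \<forall>z\<in>carrier G.
      min (Gromov_product (word_dist G S) p x y) (Gromov_product (word_dist G S) p y z) - \<delta>
        \<le> Gromov_product (word_dist G S) p x z"
    using assms by (auto simp: hyperbolic_group_def Gromov_hyperbolic_def)
  then interpret S: hyperbolic_word_metric G S \<delta>
    by unfold_locales auto
  interpret X: word_metric G X
    by unfold_locales (rule X)
  let ?C = "conjugacy_ball G X" and ?B = "X.ball"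
  have "(\<lambda>n. real (card (?C n)) / real (card (?B n))) \<longlonglongrightarrow> 0"
  proof (cases "\<exists>g. S.straight (2 * \<delta> + 1) g")
    case True
    then obtain g where g: "S.straight (2 * \<delta> + 1) g"
      by blast
    then have gG: "g \<in> carrier G"
      by (simp add: S.straight_def)
    \<comment> \<open>Positive powers of a straight element have positive length, so its cyclic
      subgroup is infinite; its infinite index then gives superlinear growth.\<close>
    have "inj (\<lambda>n::nat. g [^]\<^bsub>G\<^esub> n)"
    proof (rule linorder_injI)
      fix i j :: nat assume "i < j"
      have "g [^]\<^bsub>G\<^esub> (j - i) \<noteq> \<one>\<^bsub>G\<^esub>"
        using S.len_straight_pow [OF g, of "j - i"] \<open>i < j\<close> by auto
      then show "g [^]\<^bsub>G\<^esub> i \<noteq> g [^]\<^bsub>G\<^esub> j"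
        using pow_eq_div2 gG by metis
    qed
    then have growth: "\<forall>\<^sub>F n in sequentially. A * (n + 1) \<le> card (?B n)" for A
      using X.superlinear_growth gG infinite_rcosets_of_not_virtually_cyclic assms by blast
    have "\<exists>A. \<forall>n. K * card (?C n) \<le> card (?B n) + A * (n + 1)" for K
    proof -
      obtain A where A: "\<And>n. card {c \<in> ?C n. card (c \<inter> ?B n) < K} \<le> A * (n + 1)"
        using S.card_sparse_classes_le [OF X] by blast
      have "K * card (?C n) \<le> card (?B n) + (K * A) * (n + 1)" for n
      proof -
        let ?D = "{c \<in> ?C n. K \<le> card (c \<inter> ?B n)}" and ?E = "{c \<in> ?C n. card (c \<inter> ?B n) < K}"
        have "?C n = ?D \<union> ?E"
          by (rule subset_antisym) (simp_all add: subset_iff le_less_linear)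
        then have "card (?C n) \<le> card ?D + card ?E"
          using card_Un_le [of ?D ?E] by simp
        then have "K * card (?C n) \<le> K * card ?D + K * card ?E"
          using mult_le_mono2 [of "card (?C n)" "card ?D + card ?E" K] by (simp add: distrib_left)
        also have "\<dots> \<le> card (?B n) + K * (A * (n + 1))"
          using X.card_crowded_classes_le A by (intro add_mono mult_le_mono2)
        finally show ?thesis
          by (simp add: distrib_left mult.assoc)
      qed
      then show ?thesis
        by blast
    qed
    then show ?thesis
      using growth X.card_ball_pos by (intro ratio_tendsto_0 [where t = "\<lambda>n. n + 1"]) auto
  next
    case False
    let ?N = "S.ball (nat \<lceil>7 * \<delta> + 3\<rceil>)"
    \<comment> \<open>Every class meets the fixed ball \<open>?N\<close>, so there are only finitely
      many classes and unbounded growth of \<open>?B\<close> suffices.\<close>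
    have "?C n \<subseteq> conj_class ` ?N" for n
    proof
      fix c assume "c \<in> ?C n"
      then obtain g where g: "g \<in> carrier G" "c = conj_class g"
        by (auto simp: X.conjugacy_ball_eq X.mem_ball_iff)
      then obtain h where "h \<in> conj_class g" "h \<in> ?N"
        using S.straight_conj_of_far False by blast
      then show "c \<in> conj_class ` ?N"
        using g conj_class_eq by blast
    qed
    then have "card (?C n) \<le> card (conj_class ` ?N)" for n
      by (intro card_mono) auto
    then have "\<exists>A. \<forall>n. K * card (?C n) \<le> card (?B n) + A * 1" for K
      by (intro exI [of _ "K * card (conj_class ` ?N)"]) (auto intro: trans_le_add2)
    then show ?thesis
      using X.card_ball_pos
        X.ball_unbounded [OF infinite_carrier_of_not_virtually_cyclic [OF assms(2)]]
      by (intro ratio_tendsto_0 [where t = "\<lambda>n. 1"]) auto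
  qed
  then have "(\<lambda>n. ereal (real (card (?C n)) / real (card (?B n)))) \<longlonglongrightarrow> ereal 0"
    by simp
  then show "conjugacy_ratio G X = 0"
    unfolding conjugacy_ratio_def zero_ereal_def by (intro lim_imp_Limsup) auto
qed

end
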